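(* Let $G_1=(V_1,E_1)$ and $G_2=(V_2,E_2)$ be highly symmetric graphs, where for $i=1,2$ the graph $G_i$ has $|V_i|=n_i$ vertices, is regular of degree $d_i\ge 1$, and has Kemeny constant $K_i$. Let $G=G_1\{G_2\}=(V,E)$ be their cluster (formed with respect to any choice of vertex of $G_2$), so that $|V|=n_1n_2$ and $|E|=|E_1|+n_1|E_2|$. Then the Kemeny constant $K$ of $G$ is $$K=\frac{|E|}{|E_1|}K_1+\frac{n_1\,(2|E|-|E_2|)}{|E|}K_2 .$$
   Context: All graphs are finite, simple, connected and undirected. The simple random walk $(X_n)$ on a graph $G=(V,E)$ is the Markov chain on $V$ that jumps from a vertex to a uniformly chosen neighbor. Its stationary distribution is $\pi_i=\frac{d_i}{2|E|}$, where here $d_i$ denotes the degree of the vertex $i$. The hitting time of a vertex $b$ is $T_b=\inf\{n\ge 0: X_n=b\}$ (so $T_b=0$ if the walk starts at $b$), and $E_aT_b$ denotes its expectation when the walk starts at $a$. The Kemeny constant of $G$ is $K=\sum_{j\in V}\pi_jE_iT_j$, which does not depend on the vertex $i$. A graph is highly symmetric (HS) if $E_aT_b=E_bT_a$ for all vertices $a,b$. The cluster $G_1\{G_2\}$ of $G_1=(V_1,E_1)$ and $G_2$ is the graph obtained by selecting one vertex $r$ of $G_2$, taking $|V_1|$ disjoint copies of $G_2$, one for each vertex of $G_1$, and identifying the copy of $r$ in the copy of $G_2$ associated with $v\in V_1$ with the vertex $v$, for every $v\in V_1$. *)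

theory Defs
  imports "HOL-Probability.Probability"
begin

definition simple_graph :: "'a set \<Rightarrow> 'a set set \<Rightarrow> bool" where
  "simple_graph V E \<longleftrightarrow> finite V \<and> V \<noteq> {} \<and> E \<subseteq> {{u, v} |u v. u \<in> V \<and> v \<in> V \<and> u \<noteq> v}"

definition connected_graph :: "'a set \<Rightarrow> 'a set set \<Rightarrow> bool" where
  "connected_graph V E \<longleftrightarrow> (\<forall>u\<in>V. \<forall>v\<in>V. (u, v) \<in> {(x, y). {x, y} \<in> E}\<^sup>*)"

definition neighbors :: "'a set set \<Rightarrow> 'a \<Rightarrow> 'a set" where
  "neighbors E v = {w. {v, w} \<in> E}"

definition degree :: "'a set set \<Rightarrow> 'a \<Rightarrow> nat" where
  "degree E v = card (neighbors E v)"

definition regular_graph :: "'a set \<Rightarrow> 'a set set \<Rightarrow> nat \<Rightarrow> bool" where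
  "regular_graph V E d \<longleftrightarrow> (\<forall>v\<in>V. degree E v = d)"

text \<open>
  The walk started at \<open>a\<close> is the coordinate process on the space of all sequences of vertices.
  \<open>walk_kernel E a n \<omega>\<close> is the law of the \<open>n\<close>-th coordinate given the history
  \<open>\<omega> 0, \<dots>, \<omega> (n - 1)\<close>, and \<open>walk_measure E a\<close> is the Ionescu-Tulcea measure of these kernels;
  that this is the law of the simple random walk is \<open>walk_measure_path\<close> below.
\<close>

definition walk_kernel :: "'a set set \<Rightarrow> 'a \<Rightarrow> nat \<Rightarrow> (nat \<Rightarrow> 'a) \<Rightarrow> 'a measure" where
  "walk_kernel E a n \<omega> =
     measure_pmf (if n = 0 then return_pmf a else pmf_of_set (neighbors E (\<omega> (n - 1))))"

definition walk_measure :: "'a set set \<Rightarrow> 'a \<Rightarrow> (nat \<Rightarrow> 'a) measure" where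
  "walk_measure E a =
     projective_family.lim UNIV
       (Ionescu_Tulcea.CI (walk_kernel E a) (\<lambda>_. count_space UNIV)) (\<lambda>_. count_space UNIV)"

definition hitting_time :: "'a \<Rightarrow> (nat \<Rightarrow> 'a) \<Rightarrow> enat" where
  "hitting_time b \<omega> = (INF n\<in>{n. \<omega> n = b}. enat n)"

definition expected_hitting_time :: "'a set set \<Rightarrow> 'a \<Rightarrow> 'a \<Rightarrow> ennreal" where
  "expected_hitting_time E a b = (\<integral>\<^sup>+ \<omega>. ennreal_of_enat (hitting_time b \<omega>) \<partial>walk_measure E a)"

definition stationary :: "'a set set \<Rightarrow> 'a \<Rightarrow> real" where
  "stationary E v = real (degree E v) / (2 * real (card E))"

text \<open>The sum does not depend on the starting vertex \<open>i\<close>; it is kept as a parameter.\<close>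

definition kemeny :: "'a set \<Rightarrow> 'a set set \<Rightarrow> 'a \<Rightarrow> ennreal" where
  "kemeny V E i = (\<Sum>j\<in>V. ennreal (stationary E j) * expected_hitting_time E i j)"

definition highly_symmetric :: "'a set \<Rightarrow> 'a set set \<Rightarrow> bool" where
  "highly_symmetric V E \<longleftrightarrow>
     (\<forall>a\<in>V. \<forall>b\<in>V. expected_hitting_time E a b = expected_hitting_time E b a)"

text \<open>
  The vertex \<open>(v, x)\<close> of the cluster is the vertex \<open>x\<close> of the copy of the second graph attached
  to \<open>v\<close>; the vertex \<open>v\<close> of the first graph is identified with \<open>(v, r)\<close>.
\<close>

definition cluster_verts :: "'a set \<Rightarrow> 'b set \<Rightarrow> ('a \<times> 'b) set" where
  "cluster_verts V1 V2 = V1 \<times> V2"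

definition cluster_edges ::
    "'a set \<Rightarrow> 'a set set \<Rightarrow> 'b set set \<Rightarrow> 'b \<Rightarrow> ('a \<times> 'b) set set" where
  "cluster_edges V1 E1 E2 r =
     {{(u, r), (v, r)} |u v. {u, v} \<in> E1} \<union> {{(v, x), (v, y)} |v x y. v \<in> V1 \<and> {x, y} \<in> E2}"

lemma Ionescu_Tulcea_walk: "Ionescu_Tulcea (walk_kernel E a) (\<lambda>_. count_space UNIV)"
proof (rule Ionescu_Tulcea.intro)
  fix i :: nat
  show "walk_kernel E a i \<in> measurable (PiM {0..<i} (\<lambda>_. count_space UNIV)) (subprob_algebra (count_space UNIV))"
  proof (cases "i = 0")
    case True
    then show ?thesis
      unfolding walk_kernel_def
      by (auto simp: space_subprob_algebra measure_pmf.subprob_space_axioms intro!: measurable_const)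
  next
    case False
    have "(\<lambda>\<omega>. \<omega> (i - 1)) \<in> measurable (PiM {0..<i} (\<lambda>_. count_space UNIV)) (count_space UNIV)"
      using False by (intro measurable_component_singleton) auto
    moreover have "(\<lambda>v. measure_pmf (pmf_of_set (neighbors E v))) \<in>
        measurable (count_space UNIV) (subprob_algebra (count_space UNIV))"
      by (auto simp: space_subprob_algebra measure_pmf.subprob_space_axioms)
    ultimately show ?thesis
      unfolding walk_kernel_def using False by (auto intro: measurable_compose)
  qed
qed (simp add: walk_kernel_def prob_space_measure_pmf)

lemma walk_measure_path:
  "emeasure (walk_measure E a) {\<omega>. \<forall>i\<le>n. \<omega> i = p i} =
     ennreal (of_bool (p 0 = a) * (\<Prod>i<n. pmf (pmf_of_set (neighbors E (p i))) (p (Suc i))))"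
proof -
  let ?M = "\<lambda>_::nat. count_space (UNIV :: 'a set)"
  interpret IT: Ionescu_Tulcea "walk_kernel E a" ?M
    by (rule Ionescu_Tulcea_walk)
  have meas: "PiE {0..<n} (\<lambda>i. {p i}) \<in> sets (PiM {0..<n} ?M)" for n
    by (intro sets_PiM_I_finite) auto
  have und: "(\<lambda>_. undefined) \<in> space (PiM {0..<0::nat} ?M)"
    by (simp add: space_PiM)
  have C: "emeasure (IT.C 0 (Suc n) (\<lambda>_. undefined)) (PiE {0..<Suc n} (\<lambda>i. {p i})) =
     ennreal (of_bool (p 0 = a) * (\<Prod>i<n. pmf (pmf_of_set (neighbors E (p i))) (p (Suc i))))" for n
  proof -
    have step: "emeasure (IT.C 0 (Suc n) (\<lambda>_. undefined)) (PiE {0..<Suc n} (\<lambda>i. {p i})) =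
       emeasure (walk_kernel E a n (restrict p {0..<n})) {p n} *
       emeasure (IT.C 0 n (\<lambda>_. undefined)) (PiE {0..<n} (\<lambda>i. {p i}))" for n
    proof -
      have "emeasure (IT.C 0 (Suc n) (\<lambda>_. undefined)) (PiE {0..<Suc n} (\<lambda>i. {p i})) =
        (\<integral>\<^sup>+ \<omega>. emeasure (IT.eP n \<omega>) (PiE {0..<Suc n} (\<lambda>i. {p i})) \<partial>IT.C 0 n (\<lambda>_. undefined))"
        using meas[of "Suc n"] IT.measurable_eP[of n]
        by (simp, subst emeasure_bind[where N = "PiM {0..<Suc n} ?M"])
           (auto simp: IT.space_C[OF und] space_PiM measurable_cong_sets[OF IT.sets_C[OF und] refl])
      also have "\<dots> = (\<integral>\<^sup>+ \<omega>. emeasure (walk_kernel E a n (restrict p {0..<n})) {p n} *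
          indicator (PiE {0..<n} (\<lambda>i. {p i})) \<omega> \<partial>IT.C 0 n (\<lambda>_. undefined))"
      proof (rule nn_integral_cong)
        fix \<omega> assume "\<omega> \<in> space (IT.C 0 n (\<lambda>_. undefined))"
        then have w: "\<omega> \<in> space (PiM {0..<n} ?M)"
          by (simp add: IT.space_C[OF und])
        then have ext: "\<omega> \<in> extensional {0..<n}"
          by (simp add: space_PiM PiE_def)
        have eP: "emeasure (IT.eP n \<omega>) (PiE {0..<Suc n} (\<lambda>i. {p i})) =
          emeasure (walk_kernel E a n \<omega>) ((\<lambda>x. fun_upd \<omega> n x) -` PiE {0..<Suc n} (\<lambda>i. {p i}) \<inter> space (?M n))"
          by (rule IT.emeasure_eP[OF w meas])
        show "emeasure (IT.eP n \<omega>) (PiE {0..<Suc n} (\<lambda>i. {p i})) =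
          emeasure (walk_kernel E a n (restrict p {0..<n})) {p n} * indicator (PiE {0..<n} (\<lambda>i. {p i})) \<omega>"
        proof (cases "\<omega> \<in> PiE {0..<n} (\<lambda>i. {p i})")
          case True
          then have "\<omega> = restrict p {0..<n}"
            by (auto intro!: extensionalityI[of _ "{0..<n}"] simp: PiE_iff)
          moreover have "(\<lambda>x. fun_upd \<omega> n x) -` PiE {0..<Suc n} (\<lambda>i. {p i}) = {p n}"
            using True by (auto simp: PiE_iff extensional_def atLeastLessThanSuc)
          ultimately show ?thesis
            using eP True by simp
        next
          case False
          then obtain k where k: "k < n" "\<omega> k \<noteq> p k"
            using ext by (auto simp: PiE_iff)
          have "(\<lambda>x. fun_upd \<omega> n x) -` PiE {0..<Suc n} (\<lambda>i. {p i}) = {}"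
          proof (rule equals0I)
            fix x assume "x \<in> (\<lambda>x. fun_upd \<omega> n x) -` PiE {0..<Suc n} (\<lambda>i. {p i})"
            then have "fun_upd \<omega> n x \<in> PiE {0..<Suc n} (\<lambda>i. {p i})"
              by simp
            from PiE_mem[OF this, of k] k show False
              by simp
          qed
          then show ?thesis
            using eP False by simp
        qed
      qed
      also have "\<dots> = emeasure (walk_kernel E a n (restrict p {0..<n})) {p n} *
          emeasure (IT.C 0 n (\<lambda>_. undefined)) (PiE {0..<n} (\<lambda>i. {p i}))"
        using meas[of n] by (simp add: nn_integral_cmult_indicator IT.sets_C[OF und])
      finally show ?thesis .
    qed
    show ?thesis
    proof (induction n)
      case 0
      have "emeasure (IT.C 0 0 (\<lambda>_. undefined)) (PiE {0..<0} (\<lambda>i. {p i})) = 1"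
        by (simp add: PiM_empty)
      then show ?case
        unfolding step by (simp add: walk_kernel_def emeasure_pmf_single split: split_indicator)
    next
      case (Suc n)
      show ?case
        by (subst step, subst Suc.IH)
           (simp add: walk_kernel_def emeasure_pmf_single prod_nonneg ac_simps flip: ennreal_mult)
    qed
  qed
  have emb: "{\<omega>. \<forall>i\<le>n. \<omega> i = p i} = prod_emb UNIV ?M {0..<Suc n} (PiE {0..<Suc n} (\<lambda>i. {p i}))"
    by (auto simp: prod_emb_def space_PiM PiE_iff less_Suc_eq_le)
  show ?thesis
    unfolding walk_measure_def emb
    by (subst IT.lim) (use meas[of "Suc n"] in \<open>auto simp: IT.emeasure_CI[of _ "Suc n"] C prod_emb_id[OF PiE_mono] simp del: IT.C.simps\<close>)
qed

lemma simple_graph_cluster: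
  assumes "simple_graph V1 E1" "simple_graph V2 E2" "r \<in> V2"
  shows "simple_graph (cluster_verts V1 V2) (cluster_edges V1 E1 E2 r)"
  using assms unfolding simple_graph_def cluster_verts_def cluster_edges_def
  by (fastforce simp: doubleton_eq_iff)

end

theory Submission
  imports Defs
begin

text \<open>
  Let \<open>L f a = deg a * f a - (\<Sum>w \<sim> a. f w)\<close> be the graph Laplacian. On a finite connected graph
  with \<open>m\<close> edges the mean hitting times \<open>h(\<cdot>, b)\<close> are finite, vanish at \<open>b\<close>, and satisfy
  \<open>L h(\<cdot>, b) = deg - 2 m [\<cdot> = b]\<close>: away from \<open>b\<close> this is the first-step equation, and its value at \<open>b\<close>,
  which says that the mean return time is \<open>2 m / deg b\<close>, is forced because a Laplacian sums to \<open>0\<close>.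
  Functions with vanishing Laplacian are constant, so these equations determine \<open>h\<close>, and they also
  make the Kemeny constant independent of the starting vertex.

  In the cluster the Laplacian splits: at \<open>(u, x)\<close> it is the Laplacian of the second graph along the
  copy at \<open>u\<close>, plus, if \<open>x\<close> is the root \<open>r\<close>, the Laplacian of the first graph. This makes it possible
  to write down the hitting times of the cluster (\<open>mean_hitting_time_cluster\<close>). The copies delay the
  walk on the first graph by the factor \<open>|E| / |E1|\<close>; and inside the copy of the target \<open>(v, y)\<close>, all the
  rest of the graph acts as an excursion at \<open>r\<close>, which adds a multiple of the function
  \<open>h2(x, y) + h2(y, r) - h2(x, r)\<close>, whose Laplacian is concentrated at \<open>r\<close> and \<open>y\<close>.

  From a root \<open>(u, r)\<close> the symmetry \<open>h2(y, r) = h2(r, y)\<close> turns this into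
  \<open>h((u, r), (v, y)) = |E| / |E1| * h1(u, v) + (2 |E| - |E2|) / |E2| * h2(r, y)\<close>. Averaging over the
  stationary distribution gives the formula: by regularity of the first graph each copy has
  total mass \<open>1 / n1\<close>, and the vertices \<open>y \<noteq> r\<close> of a copy carry \<open>|E2| / |E|\<close> times their mass in the
  second graph, while \<open>y = r\<close> contributes \<open>h2(r, r) = 0\<close>.
\<close>

section \<open>Hitting times as sums of avoidance probabilities\<close>

lemma space_walk_measure [simp]: "space (walk_measure E a) = UNIV"
proof -
  interpret IT: Ionescu_Tulcea "walk_kernel E a" "\<lambda>_. count_space UNIV"
    by (rule Ionescu_Tulcea_walk)
  show ?thesis
    unfolding walk_measure_def by (simp add: space_PiM)
qed

lemma sets_walk_measure [simp, measurable_cong]: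
  "sets (walk_measure E a) = sets (PiM UNIV (\<lambda>_. count_space UNIV))"
proof -
  interpret IT: Ionescu_Tulcea "walk_kernel E a" "\<lambda>_. count_space UNIV"
    by (rule Ionescu_Tulcea_walk)
  show ?thesis
    unfolding walk_measure_def by simp
qed

lemma prob_space_walk_measure: "prob_space (walk_measure E a)"
proof -
  let ?M = "\<lambda>_::nat. count_space (UNIV :: 'a set)"
  interpret IT: Ionescu_Tulcea "walk_kernel E a" ?M
    by (rule Ionescu_Tulcea_walk)
  interpret P: prob_space "IT.CI {}"
    by (rule IT.PF.prob_space_P) auto
  have "UNIV = prod_emb UNIV ?M {} (space (PiM {} ?M))"
    by (auto simp: prod_emb_def space_PiM)
  then have "emeasure (walk_measure E a) UNIV = emeasure (IT.CI {}) (space (PiM {} ?M))"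
    unfolding walk_measure_def using IT.lim[of "{}" "space (PiM {} ?M)"] by simp
  also have "\<dots> = 1"
    using P.emeasure_space_1 IT.PF.space_P[of "{}"] by simp
  finally show ?thesis
    by (intro prob_spaceI) simp
qed

lemma coordinate_measurable:
  "{\<omega>. \<omega> i \<in> S} \<in> sets (walk_measure E a)"
proof -
  have "(\<lambda>\<omega>. \<omega> i) \<in> measurable (walk_measure E a) (count_space UNIV)"
    by (subst measurable_cong_sets[OF sets_walk_measure refl])
       (intro measurable_component_singleton UNIV_I)
  from measurable_sets[OF this, of S] show ?thesis
    by (simp add: vimage_def)
qed

lemma stay_event_measurable:
  "{\<omega>. \<forall>i\<le>(n::nat). \<omega> i \<in> S} \<in> sets (walk_measure E a)"
proof -
  have "{\<omega>. \<forall>i\<le>n. \<omega> i \<in> S} = (\<Inter>i\<in>{..n}. {\<omega>. \<omega> i \<in> S})"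
    by auto
  also have "\<dots> \<in> sets (walk_measure E a)"
    by (intro sets.finite_INT coordinate_measurable) auto
  finally show ?thesis .
qed

text \<open>
  The probability that the walk from \<open>a\<close> stays in \<open>S\<close> up to time \<open>n\<close>, computed by conditioning on the
  first step. For finite \<open>S\<close> this agrees with the path measure; the recursion is what yields the
  first-step equation for hitting times.
\<close>

primrec stay_prob :: "'a set set \<Rightarrow> 'a set \<Rightarrow> nat \<Rightarrow> 'a \<Rightarrow> real" where
  "stay_prob E S 0 a = of_bool (a \<in> S)"
| "stay_prob E S (Suc n) a =
     of_bool (a \<in> S) * (\<Sum>y\<in>S. pmf (pmf_of_set (neighbors E a)) y * stay_prob E S n y)"

lemma stay_prob_nonneg: "0 \<le> stay_prob E S n a"
  by (induction n arbitrary: a) (auto intro!: sum_nonneg mult_nonneg_nonneg)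

text \<open>
  A path is extended at its end, whereas \<open>stay_prob\<close> recurses at its beginning. Weighting each path
  by the probability of staying for another \<open>m\<close> steps reconciles the two: the last step of the path
  can be traded for one more step of the recursion.
\<close>

lemma sum_paths_stay_prob:
  assumes "finite S"
  shows "(\<Sum>p\<in>{..n} \<rightarrow>\<^sub>E S. of_bool (p 0 = a) *
      (\<Prod>i<n. pmf (pmf_of_set (neighbors E (p i))) (p (Suc i))) * stay_prob E S m (p n)) =
    stay_prob E S (n + m) a"
proof (induction n arbitrary: m)
  case 0
  have img: "{..0::nat} \<rightarrow>\<^sub>E S = (\<lambda>x. (\<lambda>_. undefined)(0 := x)) ` S"
    by (force simp: PiE_insert_eq)
  have inj: "inj_on (\<lambda>x. (\<lambda>_::nat. undefined)(0 := x)) S"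
    by (auto simp: inj_on_def fun_eq_iff split: if_splits)
  have "(\<Sum>p\<in>{..0::nat} \<rightarrow>\<^sub>E S. of_bool (p 0 = a) * stay_prob E S m (p 0)) =
      (\<Sum>x\<in>S. of_bool (x = a) * stay_prob E S m x)"
    unfolding img by (subst sum.reindex[OF inj]) simp
  also have "\<dots> = of_bool (a \<in> S) * stay_prob E S m a"
    using assms by (simp add: of_bool_def if_distrib[where f = "\<lambda>x. x * _"] sum.delta cong: if_cong)
  also have "\<dots> = stay_prob E S m a"
    by (cases m) auto
  finally show ?case
    by simp
next
  case (Suc n)
  let ?w = "\<lambda>p. of_bool (p 0 = a) * (\<Prod>i<n. pmf (pmf_of_set (neighbors E (p i))) (p (Suc i)))"
  have "(\<Sum>p\<in>{..Suc n} \<rightarrow>\<^sub>E S. of_bool (p 0 = a) *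
      (\<Prod>i<Suc n. pmf (pmf_of_set (neighbors E (p i))) (p (Suc i))) * stay_prob E S m (p (Suc n))) =
    (\<Sum>(y, p)\<in>S \<times> ({..n} \<rightarrow>\<^sub>E S). ?w p *
      (pmf (pmf_of_set (neighbors E (p n))) y * stay_prob E S m y))"
    unfolding atMost_Suc PiE_insert_eq
    by (subst sum.reindex[OF inj_combinator]) (auto simp: case_prod_beta mult_ac intro!: sum.cong)
  also have "\<dots> = (\<Sum>p\<in>{..n} \<rightarrow>\<^sub>E S. ?w p *
      (\<Sum>y\<in>S. pmf (pmf_of_set (neighbors E (p n))) y * stay_prob E S m y))"
    by (subst sum.cartesian_product[symmetric], subst sum.swap) (simp add: sum_distrib_left)
  also have "\<dots> = (\<Sum>p\<in>{..n} \<rightarrow>\<^sub>E S. ?w p * stay_prob E S (Suc m) (p n))"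
    by (intro sum.cong refl) (auto dest!: PiE_mem[where x = n])
  also have "\<dots> = stay_prob E S (n + Suc m) a"
    by (rule Suc.IH)
  finally show ?case
    by simp
qed

text \<open>
  Because \<open>S\<close> is finite, the event is a finite disjoint union of cylinders over single paths, even if
  the vertex type is uncountable.
\<close>

lemma emeasure_walk_stays:
  assumes "finite S"
  shows "emeasure (walk_measure E a) {\<omega>. \<forall>i\<le>n. \<omega> i \<in> S} = ennreal (stay_prob E S n a)"
proof -
  let ?C = "\<lambda>p. {\<omega>. \<forall>i\<le>n. \<omega> i = p i}"
  have un: "{\<omega>. \<forall>i\<le>n. \<omega> i \<in> S} = (\<Union>p\<in>{..n} \<rightarrow>\<^sub>E S. ?C p)"
  proof safe
    fix \<omega> :: "nat \<Rightarrow> 'a" assume "\<forall>i\<le>n. \<omega> i \<in> S"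
    then show "\<omega> \<in> (\<Union>p\<in>{..n} \<rightarrow>\<^sub>E S. ?C p)"
      by (intro UN_I[of "restrict \<omega> {..n}"]) auto
  qed (auto simp: PiE_iff)
  have disj: "disjoint_family_on ?C ({..n} \<rightarrow>\<^sub>E S)"
  proof (unfold disjoint_family_on_def, intro ballI impI)
    fix p q assume pq: "p \<in> {..n} \<rightarrow>\<^sub>E S" "q \<in> {..n} \<rightarrow>\<^sub>E S" "p \<noteq> q"
    then obtain i where "i \<le> n" "p i \<noteq> q i"
      using PiE_ext[OF pq(1,2)] by auto
    then show "?C p \<inter> ?C q = {}"
      by auto
  qed
  have meas: "?C p \<in> sets (walk_measure E a)" for p
  proof -
    have "?C p = (\<Inter>i\<in>{..n}. {\<omega>. \<omega> i \<in> {p i}})"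
      by auto
    also have "\<dots> \<in> sets (walk_measure E a)"
      by (intro sets.finite_INT coordinate_measurable) auto
    finally show ?thesis .
  qed
  have "emeasure (walk_measure E a) {\<omega>. \<forall>i\<le>n. \<omega> i \<in> S} =
      (\<Sum>p\<in>{..n} \<rightarrow>\<^sub>E S. emeasure (walk_measure E a) (?C p))"
    unfolding un using assms disj meas
    by (intro sum_emeasure[symmetric]) (auto intro: finite_PiE)
  also have "\<dots> = ennreal (\<Sum>p\<in>{..n} \<rightarrow>\<^sub>E S. of_bool (p 0 = a) *
      (\<Prod>i<n. pmf (pmf_of_set (neighbors E (p i))) (p (Suc i))))"
    by (simp add: walk_measure_path sum_ennreal prod_nonneg)
  also have "(\<Sum>p\<in>{..n} \<rightarrow>\<^sub>E S. of_bool (p 0 = a) *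
      (\<Prod>i<n. pmf (pmf_of_set (neighbors E (p i))) (p (Suc i)))) = stay_prob E S n a"
    using sum_paths_stay_prob[OF assms, where n = n and a = a and E = E and m = 0]
    by (subst (asm) sum.cong[OF refl, where h = "\<lambda>p. of_bool (p 0 = a) *
        (\<Prod>i<n. pmf (pmf_of_set (neighbors E (p i))) (p (Suc i)))"]) (auto dest!: PiE_mem[where x = n])
  finally show ?thesis .
qed

lemma less_hitting_time_iff: "enat n < hitting_time b \<omega> \<longleftrightarrow> (\<forall>i\<le>n. \<omega> i \<noteq> b)"
proof
  assume *: "enat n < hitting_time b \<omega>"
  show "\<forall>i\<le>n. \<omega> i \<noteq> b"
  proof (intro allI impI notI)
    fix i assume "i \<le> n" "\<omega> i = b"
    then have "hitting_time b \<omega> \<le> enat n"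
      unfolding hitting_time_def by (intro INF_lower2[of i]) auto
    with * show False
      by simp
  qed
next
  assume *: "\<forall>i\<le>n. \<omega> i \<noteq> b"
  have "enat (Suc n) \<le> hitting_time b \<omega>"
    unfolding hitting_time_def
  proof (rule INF_greatest)
    fix i assume "i \<in> {i. \<omega> i = b}"
    with * have "\<not> i \<le> n"
      by auto
    then show "enat (Suc n) \<le> enat i"
      by simp
  qed
  then show "enat n < hitting_time b \<omega>"
    using less_le_trans[of "enat n" "enat (Suc n)"] by simp
qed

lemma hitting_time_measurable:
  "hitting_time b \<in> measurable (walk_measure E a) (count_space UNIV)"
proof -
  have gt: "{\<omega>. enat n < hitting_time b \<omega>} \<in> sets (walk_measure E a)" for n
    using stay_event_measurable[of n "- {b}" E a] by (simp add: less_hitting_time_iff)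
  have eq_inf: "hitting_time b -` {\<infinity>} = (\<Inter>n. {\<omega>. enat n < hitting_time b \<omega>})"
  proof safe
    fix \<omega> assume "\<omega> \<in> (\<Inter>n. {\<omega>. enat n < hitting_time b \<omega>})"
    then show "\<omega> \<in> hitting_time b -` {\<infinity>}"
      by (cases "hitting_time b \<omega>") auto
  qed auto
  have eq_fin: "hitting_time b -` {enat k} =
      (\<Inter>n\<in>{..<k}. {\<omega>. enat n < hitting_time b \<omega>}) - {\<omega>. enat k < hitting_time b \<omega>}" for k
  proof (rule set_eqI)
    fix \<omega>
    have "t = k \<longleftrightarrow> (\<forall>n<k. n < t) \<and> \<not> k < t" for t
      by (meson less_irrefl not_less_iff_gr_or_eq)
    then show "\<omega> \<in> hitting_time b -` {enat k} \<longleftrightarrow>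
        \<omega> \<in> (\<Inter>n\<in>{..<k}. {\<omega>. enat n < hitting_time b \<omega>}) - {\<omega>. enat k < hitting_time b \<omega>}"
      by (cases "hitting_time b \<omega>") auto
  qed
  have "hitting_time b -` {t} \<inter> space (walk_measure E a) \<in> sets (walk_measure E a)" for t
  proof (cases t)
    case (enat k)
    have "(\<Inter>n\<in>{..<k}. {\<omega>. enat n < hitting_time b \<omega>}) \<in> sets (walk_measure E a)"
    proof (cases "k = 0")
      case False
      then show ?thesis
        by (intro sets.finite_INT gt) auto
    qed (use sets.top[of "walk_measure E a"] in simp)
    then show ?thesis
      using gt[of k] by (simp add: enat eq_fin sets.Diff)
  next
    case infinity
    then show ?thesis
      using gt by (simp add: eq_inf sets.countable_INT')
  qed
  then show ?thesis
    by (subst measurable_count_space_eq2_countable) (auto simp: Pi_iff)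
qed

lemma expected_hitting_time_eq_suminf:
  "expected_hitting_time E a b =
     (\<Sum>n. emeasure (walk_measure E a) {\<omega>. \<forall>i\<le>n. \<omega> i \<noteq> b})"
  unfolding expected_hitting_time_def nn_integral_enat_function[OF hitting_time_measurable]
  by (simp add: less_hitting_time_iff)

section \<open>The Laplacian and mean hitting times of a finite connected graph\<close>

definition laplacian :: "'a set set \<Rightarrow> ('a \<Rightarrow> real) \<Rightarrow> 'a \<Rightarrow> real" where
  "laplacian E f a = real (degree E a) * f a - (\<Sum>w\<in>neighbors E a. f w)"

lemma laplacian_add: "laplacian E (\<lambda>x. f x + g x) a = laplacian E f a + laplacian E g a"
  by (simp add: laplacian_def sum.distrib algebra_simps)

lemma laplacian_diff: "laplacian E (\<lambda>x. f x - g x) a = laplacian E f a - laplacian E g a"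
  by (simp add: laplacian_def sum_subtractf algebra_simps)

lemma laplacian_cmult: "laplacian E (\<lambda>x. c * f x) a = c * laplacian E f a"
  by (simp add: laplacian_def sum_distrib_left algebra_simps)

lemma laplacian_const [simp]: "laplacian E (\<lambda>_. c) a = 0"
  by (simp add: laplacian_def degree_def)

lemma laplacian_sum:
  "laplacian E (\<lambda>x. \<Sum>j\<in>J. f j x) a = (\<Sum>j\<in>J. laplacian E (f j) a)"
proof -
  have "(\<Sum>w\<in>neighbors E a. \<Sum>j\<in>J. f j w) = (\<Sum>j\<in>J. \<Sum>w\<in>neighbors E a. f j w)"
    by (rule sum.swap)
  then show ?thesis
    by (simp add: laplacian_def sum_distrib_left sum_subtractf)
qed

lemma neighbors_sym: "w \<in> neighbors E v \<longleftrightarrow> v \<in> neighbors E w"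
  by (simp add: neighbors_def insert_commute)

text \<open>
  Without isolated vertices every step of the walk is a uniform choice from a nonempty set; this
  excludes just the graph with one vertex, since the graph is connected.
\<close>

locale walk_graph =
  fixes V :: "'a set" and E :: "'a set set"
  assumes simple: "simple_graph V E"
    and connected: "connected_graph V E"
    and no_isolated: "v \<in> V \<Longrightarrow> neighbors E v \<noteq> {}"
begin

lemma finite_V: "finite V" and V_nonempty: "V \<noteq> {}"
  using simple by (auto simp: simple_graph_def)

lemma edge_ends:
  assumes "e \<in> E"
  obtains u v where "e = {u, v}" "u \<in> V" "v \<in> V" "u \<noteq> v"
  using simple assms unfolding simple_graph_def by blast

lemma neighbors_subset: "neighbors E v \<subseteq> V"
proof
  fix w assume "w \<in> neighbors E v"
  then have "{v, w} \<in> E"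
    by (simp add: neighbors_def)
  then show "w \<in> V"
    by (rule edge_ends) (auto simp: doubleton_eq_iff)
qed

lemma not_self_neighbor: "v \<notin> neighbors E v"
proof
  assume "v \<in> neighbors E v"
  then have "{v, v} \<in> E"
    by (simp add: neighbors_def)
  then show False
    by (rule edge_ends) (auto simp: doubleton_eq_iff)
qed

lemma finite_neighbors: "finite (neighbors E v)"
  using neighbors_subset finite_V by (rule finite_subset)

lemma finite_E: "finite E"
proof (rule finite_subset)
  show "E \<subseteq> Pow V"
    using simple by (auto simp: simple_graph_def)
qed (simp add: finite_V)

lemma degree_pos: "v \<in> V \<Longrightarrow> 0 < degree E v"
  using no_isolated[of v] finite_neighbors[of v] by (simp add: degree_def card_gt_0_iff)

lemma connected_induct [consumes 2, case_names start step]: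
  assumes "b \<in> V" "a \<in> V" and "P b"
    and step: "\<And>v w. v \<in> V \<Longrightarrow> w \<in> neighbors E v \<Longrightarrow> P v \<Longrightarrow> P w"
  shows "P a"
proof -
  have "(b, a) \<in> {(x, y). {x, y} \<in> E}\<^sup>*"
    using connected assms(1,2) by (auto simp: connected_graph_def)
  then have "P a \<and> a \<in> V"
  proof induction
    case (step y z)
    then have "z \<in> neighbors E y"
      by (simp add: neighbors_def)
    then show ?case
      using step.IH assms(4) neighbors_subset by blast
  qed (use assms in auto)
  then show ?thesis ..
qed

lemma sum_neighbors_swap:
  fixes f :: "'a \<Rightarrow> 'a \<Rightarrow> real"
  shows "(\<Sum>a\<in>V. \<Sum>w\<in>neighbors E a. f a w) = (\<Sum>a\<in>V. \<Sum>w\<in>neighbors E a. f w a)"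
proof -
  have N: "{w. w \<in> V \<and> w \<in> neighbors E a} = neighbors E a"
    "{w. w \<in> V \<and> a \<in> neighbors E w} = neighbors E a" for a
    using neighbors_subset[of a] neighbors_sym[of _ E a] by auto
  from sum.swap_restrict[OF finite_V finite_V, of f "\<lambda>a w. w \<in> neighbors E a"]
  show ?thesis
    unfolding N .
qed

lemma sum_laplacian: "(\<Sum>a\<in>V. laplacian E f a) = 0"
  using sum_neighbors_swap[of "\<lambda>a w. f w"]
  by (simp add: laplacian_def sum_subtractf degree_def)

lemma sum_degree: "(\<Sum>v\<in>V. degree E v) = 2 * card E"
proof -
  have deg: "degree E v = card {e \<in> E. v \<in> e}" for v
    unfolding degree_def
  proof (rule bij_betw_same_card)
    show "bij_betw (\<lambda>w. {v, w}) (neighbors E v) {e \<in> E. v \<in> e}"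
      unfolding bij_betw_def
    proof (intro conjI)
      show "inj_on (\<lambda>w. {v, w}) (neighbors E v)"
        by (auto simp: inj_on_def doubleton_eq_iff)
      show "(\<lambda>w. {v, w}) ` neighbors E v = {e \<in> E. v \<in> e}"
      proof (intro set_eqI iffI)
        fix e assume e: "e \<in> {e \<in> E. v \<in> e}"
        then obtain x y where xy: "e = {x, y}"
          by (auto elim: edge_ends)
        with e have "e = {v, if v = x then y else x}"
          by auto
        with e show "e \<in> (\<lambda>w. {v, w}) ` neighbors E v"
          by (auto simp: neighbors_def)
      qed (auto simp: neighbors_def)
    qed
  qed
  have two: "\<forall>e\<in>E. card {v \<in> V. v \<in> e} = 2"
  proof
    fix e assume "e \<in> E"
    then obtain u v where "e = {u, v}" "u \<in> V" "v \<in> V" "u \<noteq> v"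
      by (rule edge_ends)
    moreover from this have "{x \<in> V. x \<in> e} = {u, v}"
      by auto
    ultimately show "card {v \<in> V. v \<in> e} = 2"
      by simp
  qed
  show ?thesis
    unfolding deg using sum_multicount[OF finite_V finite_E two] .
qed

lemma sum_real_degree: "(\<Sum>v\<in>V. real (degree E v)) = 2 * real (card E)"
  by (simp add: sum_degree flip: of_nat_sum)

lemma card_E_pos: "0 < card E"
proof -
  obtain v where v: "v \<in> V"
    using V_nonempty by auto
  have "0 < (\<Sum>v\<in>V. degree E v)"
    using finite_V v degree_pos by (intro sum_pos2[of _ v]) auto
  then show ?thesis
    by (simp add: sum_degree)
qed

text \<open>
  The Dirichlet energy \<open>\<Sum>a. \<Sum>w \<sim> a. (f a - f w)\<^sup>2\<close> equals \<open>2 * (\<Sum>a. f a * L f a)\<close>, so if the latter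
  terms vanish then \<open>f\<close> does not change along any edge. The hypothesis covers both harmonic functions
  and functions that vanish at the only vertex where they are not harmonic.
\<close>

lemma constant_if_laplacian_zero:
  assumes zero: "\<And>a. a \<in> V \<Longrightarrow> f a * laplacian E f a = 0"
    and "a \<in> V" "b \<in> V"
  shows "f a = f b"
proof -
  have "(\<Sum>a\<in>V. \<Sum>w\<in>neighbors E a. (f a - f w)\<^sup>2) =
      (\<Sum>a\<in>V. \<Sum>w\<in>neighbors E a. (f a)\<^sup>2 - 2 * f a * f w) + (\<Sum>a\<in>V. \<Sum>w\<in>neighbors E a. (f w)\<^sup>2)"
    by (simp add: power2_diff sum.distrib sum_subtractf algebra_simps)
  also have "(\<Sum>a\<in>V. \<Sum>w\<in>neighbors E a. (f w)\<^sup>2) = (\<Sum>a\<in>V. \<Sum>w\<in>neighbors E a. (f a)\<^sup>2)"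
    by (rule sum_neighbors_swap)
  also have "(\<Sum>a\<in>V. \<Sum>w\<in>neighbors E a. (f a)\<^sup>2 - 2 * f a * f w) + \<dots> =
      2 * (\<Sum>a\<in>V. f a * laplacian E f a)"
    by (simp add: laplacian_def degree_def sum_subtractf sum_distrib_left algebra_simps power2_eq_square
        flip: sum.distrib)
  also have "\<dots> = 0"
    using zero by (subst sum.neutral) auto
  finally have "(\<Sum>a\<in>V. \<Sum>w\<in>neighbors E a. (f a - f w)\<^sup>2) = 0" .
  then have row: "(\<Sum>w\<in>neighbors E a. (f a - f w)\<^sup>2) = 0" if "a \<in> V" for a
    using that by (subst (asm) sum_nonneg_eq_0_iff) (auto intro: sum_nonneg finite_V)
  have edge: "f a = f w" if "a \<in> V" "w \<in> neighbors E a" for a w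
    using row[OF that(1)] that(2) by (subst (asm) sum_nonneg_eq_0_iff) (auto intro: finite_neighbors)
  from assms(3,2) show ?thesis
    by (induction rule: connected_induct) (use edge in auto)
qed

lemma sum_pmf_neighbors:
  assumes "a \<in> V"
  shows "(\<Sum>y\<in>V. pmf (pmf_of_set (neighbors E a)) y * f y) =
    (\<Sum>y\<in>neighbors E a. f y) / real (degree E a)"
proof -
  have "(\<Sum>y\<in>V. pmf (pmf_of_set (neighbors E a)) y * f y) =
      (\<Sum>y\<in>V. if y \<in> neighbors E a then f y / real (degree E a) else 0)"
    using no_isolated[OF assms] finite_neighbors
    by (intro sum.cong) (auto simp: degree_def)
  also have "\<dots> = (\<Sum>y\<in>neighbors E a. f y / real (degree E a))"
    using finite_V neighbors_subset by (simp add: sum.If_cases Int_absorb1)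
  finally show ?thesis
    by (simp add: sum_divide_distrib)
qed

lemma stay_prob_V: "a \<in> V \<Longrightarrow> stay_prob E V n a = 1"
proof (induction n arbitrary: a)
  case (Suc n)
  have "stay_prob E V (Suc n) a = (\<Sum>y\<in>V. pmf (pmf_of_set (neighbors E a)) y * 1)"
    using Suc by (auto intro!: sum.cong)
  also have "\<dots> = 1"
    using degree_pos[OF Suc.prems] by (subst sum_pmf_neighbors[OF Suc.prems]) (simp add: degree_def)
  finally show ?case .
qed simp

text \<open>
  Avoiding \<open>b\<close> leaves a possibly infinite set of allowed values, but the walk almost surely stays in
  \<open>V\<close>, so the event differs from staying in the finite set \<open>V - {b}\<close> only by a null set.
\<close>

lemma emeasure_avoid:
  assumes "a \<in> V"
  shows "emeasure (walk_measure E a) {\<omega>. \<forall>i\<le>n. \<omega> i \<noteq> b} = ennreal (stay_prob E (V - {b}) n a)"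
proof -
  interpret W: prob_space "walk_measure E a"
    by (rule prob_space_walk_measure)
  have "emeasure (walk_measure E a) {\<omega>. \<forall>i\<le>n. \<omega> i \<in> V} = 1"
    using emeasure_walk_stays[OF finite_V, of E a n] by (simp add: stay_prob_V[OF assms])
  then have "AE \<omega> in walk_measure E a. \<omega> \<in> {\<omega>. \<forall>i\<le>n. \<omega> i \<in> V}"
    by (intro W.AE_prob_1) (simp add: W.emeasure_eq_measure)
  then have "AE \<omega> in walk_measure E a. (\<omega> \<in> {\<omega>. \<forall>i\<le>n. \<omega> i \<noteq> b}) = (\<omega> \<in> {\<omega>. \<forall>i\<le>n. \<omega> i \<in> V - {b}})"
    by eventually_elim auto
  then have "emeasure (walk_measure E a) {\<omega>. \<forall>i\<le>n. \<omega> i \<noteq> b} =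
      emeasure (walk_measure E a) {\<omega>. \<forall>i\<le>n. \<omega> i \<in> V - {b}}"
    using stay_event_measurable[of n "- {b}" E a] stay_event_measurable[of n "V - {b}" E a]
    by (intro emeasure_eq_AE) auto
  then show ?thesis
    by (simp only: emeasure_walk_stays[OF finite_Diff[OF finite_V]])
qed

lemma stay_prob_target [simp]: "stay_prob E (V - {b}) n b = 0"
  by (cases n) auto

lemma degree_mult_stay_prob_Suc:
  assumes "a \<in> V - {b}"
  shows "real (degree E a) * stay_prob E (V - {b}) (Suc n) a =
    (\<Sum>w\<in>neighbors E a. stay_prob E (V - {b}) n w)"
proof -
  have "(\<Sum>y\<in>V - {b}. pmf (pmf_of_set (neighbors E a)) y * stay_prob E (V - {b}) n y) =
      (\<Sum>y\<in>V. pmf (pmf_of_set (neighbors E a)) y * stay_prob E (V - {b}) n y)"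
    using finite_V by (intro sum.mono_neutral_left) auto
  then show ?thesis
    using assms degree_pos[of a] by (simp add: sum_pmf_neighbors)
qed

definition mean_hitting_time :: "'a \<Rightarrow> 'a \<Rightarrow> real" where
  "mean_hitting_time a b = (\<Sum>n. stay_prob E (V - {b}) n a)"

text \<open>
  The first-step equation for the expectation of the hitting time truncated at a finite horizon. It
  is proved before finiteness of the hitting time is known, and is used to establish it.
\<close>

lemma truncated_step:
  assumes "a \<in> V - {b}"
  shows "real (degree E a) * (\<Sum>n<Suc N. stay_prob E (V - {b}) n a) =
    real (degree E a) + (\<Sum>w\<in>neighbors E a. \<Sum>n<N. stay_prob E (V - {b}) n w)"
proof -
  have "real (degree E a) * (\<Sum>n<Suc N. stay_prob E (V - {b}) n a) =
      real (degree E a) * stay_prob E (V - {b}) 0 a +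
      (\<Sum>n<N. real (degree E a) * stay_prob E (V - {b}) (Suc n) a)"
    by (simp only: sum.lessThan_Suc_shift distrib_left sum_distrib_left)
  also have "\<dots> = real (degree E a) + (\<Sum>n<N. \<Sum>w\<in>neighbors E a. stay_prob E (V - {b}) n w)"
    using assms by (simp only: degree_mult_stay_prob_Suc) simp
  finally show ?thesis
    by (subst sum.swap)
qed

text \<open>
  Sum the truncated first-step equation over all \<open>a \<noteq> b\<close>, weighted by degree. The right-hand side is the
  degree-weighted sum of the truncated expectations except that the neighbors of \<open>b\<close> are counted once
  too seldom; since the expectations grow with the horizon, this deficit is at most the sum of the
  degrees. In the limit it is the formula for the mean return time to \<open>b\<close>.
\<close>

lemma truncated_neighbor_bound:
  assumes "b \<in> V"
  shows "(\<Sum>w\<in>neighbors E b. \<Sum>n<N. stay_prob E (V - {b}) n w) \<le> 2 * real (card E)"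
proof -
  let ?H = "\<lambda>N a. \<Sum>n<N. stay_prob E (V - {b}) n a"
  have "(\<Sum>a\<in>V. real (degree E a) * ?H N a) \<le> (\<Sum>a\<in>V. real (degree E a) * ?H (Suc N) a)"
    by (intro sum_mono mult_left_mono) (auto simp: stay_prob_nonneg)
  also have "\<dots> = (\<Sum>a\<in>V - {b}. real (degree E a) * ?H (Suc N) a)"
    using assms finite_V by (subst sum.remove[of _ b]) auto
  also have "\<dots> = (\<Sum>a\<in>V - {b}. real (degree E a)) + (\<Sum>a\<in>V - {b}. \<Sum>w\<in>neighbors E a. ?H N w)"
    by (subst sum.cong[OF refl truncated_step]) (simp_all only: sum.distrib)
  also have "(\<Sum>a\<in>V - {b}. real (degree E a)) \<le> (\<Sum>a\<in>V. real (degree E a))"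
    using finite_V by (intro sum_mono2) auto
  also have "(\<Sum>a\<in>V. real (degree E a)) = 2 * real (card E)"
    by (rule sum_real_degree)
  also have "(\<Sum>a\<in>V - {b}. \<Sum>w\<in>neighbors E a. ?H N w) =
      (\<Sum>a\<in>V. \<Sum>w\<in>neighbors E a. ?H N w) - (\<Sum>w\<in>neighbors E b. ?H N w)"
    using assms finite_V by (subst sum.remove[of V b]) auto
  also have "(\<Sum>a\<in>V. \<Sum>w\<in>neighbors E a. ?H N w) = (\<Sum>a\<in>V. real (degree E a) * ?H N a)"
    by (subst sum_neighbors_swap) (simp add: degree_def)
  finally show ?thesis
    by simp
qed

text \<open>
  The bound at the neighbors of \<open>b\<close> spreads along edges: by the first-step equation a neighbor of
  \<open>v \<noteq> b\<close> has truncated expectation at most \<open>deg v\<close> times that of \<open>v\<close>.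
\<close>

lemma summable_stay_prob:
  assumes "a \<in> V" "b \<in> V"
  shows "summable (\<lambda>n. stay_prob E (V - {b}) n a)"
proof -
  let ?H = "\<lambda>N a. \<Sum>n<N. stay_prob E (V - {b}) n a"
  have "\<exists>B. \<forall>N. ?H N a \<le> B"
    using assms(2,1)
  proof (induction rule: connected_induct)
    case start
    show ?case
      by (auto intro!: exI[of _ 0])
  next
    case (step v w)
    have H0: "0 \<le> ?H N x" for N x
      by (intro sum_nonneg stay_prob_nonneg)
    have w_le: "?H N w \<le> (\<Sum>w\<in>neighbors E v. ?H N w)" for N
      using step.hyps finite_neighbors by (intro member_le_sum H0) auto
    show ?case
    proof (cases "v = b")
      case True
      then show ?thesis
        by (intro exI[of _ "2 * real (card E)"] allI order_trans[OF w_le])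
          (simp only: truncated_neighbor_bound[OF assms(2)])
    next
      case False
      obtain B where B: "\<And>N. ?H N v \<le> B"
        using step.IH by auto
      have "?H N w \<le> real (degree E v) * B" for N
      proof -
        have "?H N w \<le> (\<Sum>w\<in>neighbors E v. ?H N w)"
          by (rule w_le)
        also have "\<dots> \<le> real (degree E v) * ?H (Suc N) v"
          using truncated_step[of v b N] step.hyps False by simp
        also have "\<dots> \<le> real (degree E v) * B"
          by (intro mult_left_mono B) simp
        finally show ?thesis .
      qed
      then show ?thesis
        by blast
    qed
  qed
  then obtain B where "\<And>N. ?H N a \<le> B"
    by blast
  then show ?thesis
    by (intro summableI_nonneg_bounded stay_prob_nonneg)
qed

lemma expected_hitting_time_eq:
  assumes "a \<in> V" "b \<in> V"
  shows "expected_hitting_time E a b = ennreal (mean_hitting_time a b)"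
  unfolding expected_hitting_time_eq_suminf mean_hitting_time_def emeasure_avoid[OF assms(1)]
  by (intro suminf_ennreal2 stay_prob_nonneg summable_stay_prob assms)

lemma mean_hitting_time_self [simp]: "mean_hitting_time b b = 0"
  by (simp add: mean_hitting_time_def)

lemma mean_hitting_time_nonneg: "a \<in> V \<Longrightarrow> b \<in> V \<Longrightarrow> 0 \<le> mean_hitting_time a b"
  unfolding mean_hitting_time_def by (intro suminf_nonneg summable_stay_prob stay_prob_nonneg)

text \<open>
  The value at \<open>b\<close> follows from those elsewhere, as the Laplacian sums to \<open>0\<close> over the graph.
\<close>

lemma laplacian_mean_hitting_time:
  assumes "a \<in> V" "b \<in> V"
  shows "laplacian E (\<lambda>x. mean_hitting_time x b) a =
    real (degree E a) - (if a = b then 2 * real (card E) else 0)"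
proof -
  let ?L = "laplacian E (\<lambda>x. mean_hitting_time x b)"
  have off: "?L x = real (degree E x)" if "x \<in> V - {b}" for x
  proof -
    have lim: "(\<lambda>N. \<Sum>n<N. stay_prob E (V - {b}) n y) \<longlonglongrightarrow> mean_hitting_time y b" if "y \<in> V" for y
      unfolding mean_hitting_time_def using that assms by (intro summable_LIMSEQ summable_stay_prob)
    have "(\<lambda>N. real (degree E x) * (\<Sum>n<Suc N. stay_prob E (V - {b}) n x))
        \<longlonglongrightarrow> real (degree E x) * mean_hitting_time x b"
      using that by (intro tendsto_mult tendsto_const LIMSEQ_Suc[OF lim]) auto
    moreover have "(\<lambda>N. real (degree E x) + (\<Sum>w\<in>neighbors E x. \<Sum>n<N. stay_prob E (V - {b}) n w))
        \<longlonglongrightarrow> real (degree E x) + (\<Sum>w\<in>neighbors E x. mean_hitting_time w b)"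
      using neighbors_subset by (intro tendsto_add tendsto_const tendsto_sum lim) auto
    ultimately have "real (degree E x) * mean_hitting_time x b =
        real (degree E x) + (\<Sum>w\<in>neighbors E x. mean_hitting_time w b)"
      unfolding truncated_step[OF that] by (rule LIMSEQ_unique)
    then show ?thesis
      by (simp add: laplacian_def)
  qed
  have "0 = ?L b + (\<Sum>x\<in>V - {b}. ?L x)"
    using sum_laplacian[of "\<lambda>x. mean_hitting_time x b"] assms finite_V by (simp add: sum.remove[of V b])
  also have "(\<Sum>x\<in>V - {b}. ?L x) = (\<Sum>x\<in>V - {b}. real (degree E x))"
    by (intro sum.cong refl off)
  also have "\<dots> = 2 * real (card E) - real (degree E b)"
  proof -
    have "2 * real (card E) = (\<Sum>x\<in>V. real (degree E x))"
      by (simp add: sum_real_degree)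
    also have "\<dots> = real (degree E b) + (\<Sum>x\<in>V - {b}. real (degree E x))"
      using assms finite_V by (simp add: sum.remove[of V b])
    finally show ?thesis
      by simp
  qed
  finally show ?thesis
    using off[of a] assms by auto
qed

lemma mean_hitting_time_unique:
  assumes "b \<in> V" "f b = 0"
    and step: "\<And>a. a \<in> V \<Longrightarrow> a \<noteq> b \<Longrightarrow> laplacian E f a = real (degree E a)"
    and "a \<in> V"
  shows "mean_hitting_time a b = f a"
proof -
  have "mean_hitting_time a b - f a = mean_hitting_time b b - f b"
  proof (rule constant_if_laplacian_zero)
    fix x assume "x \<in> V"
    then show "(mean_hitting_time x b - f x) * laplacian E (\<lambda>x. mean_hitting_time x b - f x) x = 0"
      using assms by (cases "x = b") (simp_all add: laplacian_diff laplacian_mean_hitting_time)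
  qed (use assms in auto)
  then show ?thesis
    using assms by simp
qed

definition mean_kemeny :: "'a \<Rightarrow> real" where
  "mean_kemeny i = (\<Sum>j\<in>V. stationary E j * mean_hitting_time i j)"

lemma kemeny_eq:
  assumes "i \<in> V"
  shows "kemeny V E i = ennreal (mean_kemeny i)"
proof -
  have pos: "0 \<le> stationary E j" for j
    by (simp add: stationary_def)
  have "kemeny V E i = (\<Sum>j\<in>V. ennreal (stationary E j * mean_hitting_time i j))"
    unfolding kemeny_def using assms pos
    by (intro sum.cong refl) (simp add: expected_hitting_time_eq ennreal_mult mean_hitting_time_nonneg)
  also have "\<dots> = ennreal (mean_kemeny i)"
    unfolding mean_kemeny_def using assms pos
    by (intro sum_ennreal mult_nonneg_nonneg mean_hitting_time_nonneg)
  finally show ?thesis .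
qed

lemma mean_kemeny_nonneg: "i \<in> V \<Longrightarrow> 0 \<le> mean_kemeny i"
  unfolding mean_kemeny_def
  by (intro sum_nonneg mult_nonneg_nonneg mean_hitting_time_nonneg) (auto simp: stationary_def)

lemma sum_stationary: "(\<Sum>j\<in>V. stationary E j) = 1"
  using card_E_pos by (simp add: stationary_def sum_real_degree flip: sum_divide_distrib)

text \<open>
  As a function of the starting vertex the Kemeny sum is harmonic: averaging
  \<open>deg a - 2 m [a = j]\<close> over the stationary law of \<open>j\<close> gives \<open>deg a - 2 m * \<pi> a = 0\<close>.
\<close>

lemma mean_kemeny_start_indep:
  assumes "i \<in> V" "k \<in> V"
  shows "mean_kemeny i = mean_kemeny k"
proof (rule constant_if_laplacian_zero)
  fix a assume a: "a \<in> V"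
  have "laplacian E mean_kemeny a =
      (\<Sum>j\<in>V. stationary E j * (real (degree E a) - (if a = j then 2 * real (card E) else 0)))"
    using a unfolding mean_kemeny_def[abs_def]
    by (simp add: laplacian_sum laplacian_cmult laplacian_mean_hitting_time)
  also have "\<dots> = real (degree E a) * (\<Sum>j\<in>V. stationary E j) -
      (\<Sum>j\<in>V. if a = j then stationary E j * (2 * real (card E)) else 0)"
    unfolding sum_distrib_left sum_subtractf[symmetric] by (intro sum.cong) (auto simp: algebra_simps)
  also have "\<dots> = 0"
    using a finite_V card_E_pos by (simp add: sum_stationary sum.delta) (simp add: stationary_def)
  finally show "mean_kemeny a * laplacian E mean_kemeny a = 0"
    by simp
qed (use assms in auto)

end

section \<open>The cluster of two graphs\<close>

lemma neighbors_cluster: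
  assumes "u \<in> V1"
  shows "neighbors (cluster_edges V1 E1 E2 r) (u, x) =
    (\<lambda>y. (u, y)) ` neighbors E2 x \<union> (if x = r then (\<lambda>v. (v, r)) ` neighbors E1 u else {})"
proof (rule set_eqI, clarify)
  fix w z
  have "(\<exists>a b. {(u, x), (w, z)} = {(a, r), (b, r)} \<and> {a, b} \<in> E1) \<longleftrightarrow> x = r \<and> z = r \<and> {u, w} \<in> E1"
    by (auto simp: doubleton_eq_iff insert_commute[of w u])
  moreover have "(\<exists>v y y'. {(u, x), (w, z)} = {(v, y), (v, y')} \<and> v \<in> V1 \<and> {y, y'} \<in> E2) \<longleftrightarrow>
      w = u \<and> {x, z} \<in> E2"
    using assms by (auto simp: doubleton_eq_iff insert_commute[of z x])
  ultimately show "(w, z) \<in> neighbors (cluster_edges V1 E1 E2 r) (u, x) \<longleftrightarrow>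
      (w, z) \<in> (\<lambda>y. (u, y)) ` neighbors E2 x \<union>
        (if x = r then (\<lambda>v. (v, r)) ` neighbors E1 u else {})"
    by (auto simp: neighbors_def cluster_edges_def)
qed

locale graph_cluster = G1: walk_graph V1 E1 + G2: walk_graph V2 E2
  for V1 :: "'a set" and E1 and V2 :: "'b set" and E2 +
  fixes r :: 'b
  assumes root: "r \<in> V2"
begin

abbreviation "VC \<equiv> cluster_verts V1 V2"
abbreviation "EC \<equiv> cluster_edges V1 E1 E2 r"

lemma sum_cluster_verts: "(\<Sum>p\<in>VC. f p) = (\<Sum>u\<in>V1. \<Sum>x\<in>V2. f (u, x))"
  by (simp add: cluster_verts_def sum.cartesian_product)

lemma sum_neighbors_cluster:
  fixes f :: "'a \<times> 'b \<Rightarrow> real"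
  assumes "u \<in> V1"
  shows "(\<Sum>z\<in>neighbors EC (u, x). f z) = (\<Sum>y\<in>neighbors E2 x. f (u, y)) +
    (if x = r then \<Sum>v\<in>neighbors E1 u. f (v, r) else 0)"
proof -
  have inj: "inj_on (\<lambda>y. (u, y)) A" "inj_on (\<lambda>v. (v, r)) B" for A B
    by (auto simp: inj_on_def)
  have "(\<lambda>y. (u, y)) ` neighbors E2 x \<inter> (\<lambda>v. (v, r)) ` neighbors E1 u = {}"
    using G1.not_self_neighbor by auto
  then show ?thesis
    unfolding neighbors_cluster[OF assms]
    by (auto simp: sum.union_disjoint sum.reindex[OF inj(1)] sum.reindex[OF inj(2)]
        G1.finite_neighbors G2.finite_neighbors)
qed

lemma degree_cluster:
  assumes "u \<in> V1"
  shows "degree EC (u, x) = degree E2 x + (if x = r then degree E1 u else 0)"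
proof -
  have "real (degree EC (u, x)) = real (degree E2 x + (if x = r then degree E1 u else 0))"
    using sum_neighbors_cluster[OF assms, of "\<lambda>_. 1" x] by (simp add: degree_def)
  then show ?thesis
    by (simp only: of_nat_eq_iff)
qed

text \<open>
  Every edge of the cluster lies either inside one copy of the second graph or between two roots.
\<close>

lemma laplacian_cluster:
  assumes "u \<in> V1"
  shows "laplacian EC f (u, x) = laplacian E2 (\<lambda>y. f (u, y)) x +
    (if x = r then laplacian E1 (\<lambda>v. f (v, r)) u else 0)"
  by (simp add: laplacian_def degree_cluster[OF assms] sum_neighbors_cluster[OF assms] algebra_simps)

lemma connected_cluster: "connected_graph VC EC"
proof -
  let ?R = "{(p, q). {p, q} \<in> EC}"
  have in_copy: "((u, x), (u, y)) \<in> ?R\<^sup>*" if "u \<in> V1" "x \<in> V2" "y \<in> V2" for u x y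
    using that(2,3)
  proof (induction rule: G2.connected_induct)
    case (step y z)
    then have "((u, y), (u, z)) \<in> ?R"
      using \<open>u \<in> V1\<close> by (auto simp: cluster_edges_def neighbors_def)
    with step.IH show ?case
      by (rule rtrancl_into_rtrancl)
  qed simp
  have roots: "((u, r), (v, r)) \<in> ?R\<^sup>*" if "u \<in> V1" "v \<in> V1" for u v
    using that
  proof (induction rule: G1.connected_induct)
    case (step v w)
    then have "((v, r), (w, r)) \<in> ?R"
      by (auto simp: cluster_edges_def neighbors_def)
    with step.IH show ?case
      by (rule rtrancl_into_rtrancl)
  qed simp
  show ?thesis
    unfolding connected_graph_def
  proof (intro ballI)
    fix p q assume "p \<in> VC" "q \<in> VC"
    then obtain u x v y where *: "p = (u, x)" "q = (v, y)" "u \<in> V1" "v \<in> V1" "x \<in> V2" "y \<in> V2"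
      by (auto simp: cluster_verts_def)
    have "(p, (u, r)) \<in> ?R\<^sup>*" "((u, r), (v, r)) \<in> ?R\<^sup>*" "((v, r), q) \<in> ?R\<^sup>*"
      using * in_copy roots root by auto
    then show "(p, q) \<in> ?R\<^sup>*"
      by (meson rtrancl_trans)
  qed
qed

sublocale GC: walk_graph VC EC
proof
  show "simple_graph VC EC"
    using G1.simple G2.simple root by (rule simple_graph_cluster)
  show "connected_graph VC EC"
    by (rule connected_cluster)
  show "neighbors EC v \<noteq> {}" if "v \<in> VC" for v
    using that G2.no_isolated
    by (auto simp: cluster_verts_def neighbors_cluster)
qed

lemma card_cluster_edges: "card EC = card E1 + card V1 * card E2"
proof -
  have "2 * card EC = (\<Sum>u\<in>V1. \<Sum>x\<in>V2. degree EC (u, x))"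
    by (simp only: GC.sum_degree[symmetric] sum_cluster_verts)
  also have "\<dots> = (\<Sum>u\<in>V1. \<Sum>x\<in>V2. degree E2 x + (if x = r then degree E1 u else 0))"
    by (intro sum.cong refl degree_cluster)
  also have "\<dots> = 2 * (card E1 + card V1 * card E2)"
    using root by (simp add: sum.distrib sum.delta G2.finite_V G1.sum_degree G2.sum_degree)
  finally show ?thesis
    by simp
qed

end

locale regular_cluster = graph_cluster +
  fixes d1 :: nat
  assumes regular: "regular_graph V1 E1 d1"
begin

lemma card_V1_d1: "card V1 * d1 = 2 * card E1"
  using G1.sum_degree regular by (simp add: regular_graph_def)

text \<open>
  The right-hand side vanishes at \<open>(v, y)\<close>, so it suffices to check its Laplacian elsewhere. Away from
  the roots only the second graph is involved. At a root other than \<open>(v, r)\<close> the walk inside the copy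
  has defect \<open>2 |E2|\<close>, which the first graph compensates because \<open>\<alpha> * d1 = d1 + 2 |E2|\<close>. At \<open>(v, r)\<close>
  the first graph in addition contributes the defect \<open>2 |E|\<close> of the scaled hitting times of \<open>v\<close>; the
  term with factor \<open>c\<close> has Laplacian \<open>2 c |E2|\<close> there, and \<open>c\<close> is chosen such that
  \<open>2 c |E2| + 2 |E2| = 2 |E|\<close>. For \<open>y = r\<close> that term vanishes identically.
\<close>

lemma mean_hitting_time_cluster:
  assumes u: "u \<in> V1" and v: "v \<in> V1" and x: "x \<in> V2" and y: "y \<in> V2"
  defines "\<alpha> \<equiv> real (card EC) / real (card E1)"
    and "c \<equiv> (real (card EC) - real (card E2)) / real (card E2)"
  defines "A \<equiv> \<lambda>x. G2.mean_hitting_time x y +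
    c * (G2.mean_hitting_time x y + G2.mean_hitting_time y r - G2.mean_hitting_time x r)"
  shows "GC.mean_hitting_time (u, x) (v, y) = \<alpha> * G1.mean_hitting_time u v +
    (if u = v then A x else A r + G2.mean_hitting_time x r)"
proof -
  define f where "f = (\<lambda>(u, x). \<alpha> * G1.mean_hitting_time u v +
    (if u = v then A x else A r + G2.mean_hitting_time x r))"
  have m1: "real (card E1) > 0" and m2: "real (card E2) > 0"
    using G1.card_E_pos G2.card_E_pos by simp_all
  have \<alpha>_m1: "\<alpha> * real (card E1) = real (card EC)"
    using m1 by (simp add: \<alpha>_def)
  have c_m2: "c * real (card E2) = real (card EC) - real (card E2)"
    using m2 by (simp add: c_def)
  have \<alpha>_d1: "\<alpha> * real d1 = real d1 + 2 * real (card E2)"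
  proof -
    have n1: "real (card V1) > 0"
      using G1.finite_V G1.V_nonempty by (simp add: card_gt_0_iff)
    have nd: "real (card V1) * real d1 = 2 * real (card E1)"
      using card_V1_d1 by (metis of_nat_mult of_nat_numeral)
    have "real (card V1) * (\<alpha> * real d1) = 2 * (\<alpha> * real (card E1))"
      using nd by simp
    also have "\<dots> = real (card V1) * (real d1 + 2 * real (card E2))"
      using nd by (simp add: \<alpha>_m1 card_cluster_edges algebra_simps)
    finally show ?thesis
      using n1 by simp
  qed
  have lap_A: "laplacian E2 A a = real (degree E2 a) + (if a = r then 2 * c * real (card E2) else 0)"
    if "a \<in> V2" "a \<noteq> y" for a
    using that y root unfolding A_def
    by (simp add: laplacian_add laplacian_diff laplacian_cmult G2.laplacian_mean_hitting_time)
  have roots: "(\<lambda>w. f (w, r)) = (\<lambda>w. \<alpha> * G1.mean_hitting_time w v + A r)"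
    by (auto simp: f_def)
  have lap1: "laplacian E1 (\<lambda>w. f (w, r)) a = \<alpha> * (real d1 - (if a = v then 2 * real (card E1) else 0))"
    if "a \<in> V1" for a
    using that v regular unfolding roots
    by (simp add: laplacian_add laplacian_cmult G1.laplacian_mean_hitting_time regular_graph_def)
  have "GC.mean_hitting_time (u, x) (v, y) = f (u, x)"
  proof (rule GC.mean_hitting_time_unique)
    show "f (v, y) = 0"
      by (simp add: f_def A_def)
    fix p assume "p \<in> VC" and p_ne: "p \<noteq> (v, y)"
    then obtain a z where p: "p = (a, z)" "a \<in> V1" "z \<in> V2"
      by (auto simp: cluster_verts_def)
    show "laplacian EC f p = real (degree EC p)"
    proof (cases "a = v")
      case True
      then have "(\<lambda>z. f (a, z)) = A"
        by (auto simp: f_def)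
      then have "laplacian EC f p = laplacian E2 A z +
          (if z = r then \<alpha> * (real d1 - 2 * real (card E1)) else 0)"
        using p lap1[of a] True by (simp add: laplacian_cluster)
      also have "\<dots> = real (degree EC p)"
        using p p_ne True lap_A[of z] \<alpha>_d1 \<alpha>_m1 c_m2 regular
        by (auto simp: degree_cluster regular_graph_def algebra_simps)
      finally show ?thesis .
    next
      case False
      then have "(\<lambda>z. f (a, z)) =
          (\<lambda>z. (\<alpha> * G1.mean_hitting_time a v + A r) + G2.mean_hitting_time z r)"
        by (auto simp: f_def)
      then have "laplacian EC f p = real (degree E2 z) - (if z = r then 2 * real (card E2) else 0) +
          (if z = r then \<alpha> * real d1 else 0)"
        using p lap1[of a] False root
        by (simp add: laplacian_cluster laplacian_add G2.laplacian_mean_hitting_time)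
      also have "\<dots> = real (degree EC p)"
        using p \<alpha>_d1 regular by (auto simp: degree_cluster regular_graph_def)
      finally show ?thesis .
    qed
  qed (use assms in \<open>auto simp: cluster_verts_def\<close>)
  then show ?thesis
    by (simp add: f_def)
qed

text \<open>
  Symmetry makes the excursion term at \<open>r\<close> equal to \<open>2 * h2(r, y)\<close>, a multiple of the hitting time
  itself. Starting from a root also makes the cases \<open>u = v\<close> and \<open>u \<noteq> v\<close> coincide.
\<close>

lemma mean_hitting_time_cluster_root:
  assumes "u \<in> V1" "v \<in> V1" "y \<in> V2"
    and symm: "G2.mean_hitting_time y r = G2.mean_hitting_time r y"
  shows "GC.mean_hitting_time (u, r) (v, y) =
    real (card EC) / real (card E1) * G1.mean_hitting_time u v +
    (2 * real (card EC) - real (card E2)) / real (card E2) * G2.mean_hitting_time r y"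
  using G2.card_E_pos
  by (simp add: mean_hitting_time_cluster[OF assms(1,2) root assms(3)] symm) (simp add: field_simps)

lemma sum_stationary_cluster:
  assumes "v \<in> V1"
  shows "(\<Sum>y\<in>V2. stationary EC (v, y)) = stationary E1 v"
proof -
  have d: "degree E1 v = d1"
    using assms regular by (simp add: regular_graph_def)
  have nd: "real (card V1) * real d1 = 2 * real (card E1)"
    using card_V1_d1 by (metis of_nat_mult of_nat_numeral)
  have "(\<Sum>y\<in>V2. real (degree EC (v, y))) =
      (\<Sum>y\<in>V2. real (degree E2 y) + (if y = r then real d1 else 0))"
    using assms by (intro sum.cong) (auto simp: degree_cluster d)
  also have "\<dots> = 2 * real (card E2) + real d1"
    using root by (simp add: sum.distrib sum.delta G2.finite_V G2.sum_real_degree)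
  finally have "(\<Sum>y\<in>V2. real (degree EC (v, y))) = 2 * real (card E2) + real d1" .
  moreover have "real (card E1) * (2 * real (card E2) + real d1) = real d1 * real (card EC)"
    using nd by (simp add: card_cluster_edges algebra_simps)
  ultimately show ?thesis
    using G1.card_E_pos GC.card_E_pos
    by (simp add: stationary_def d field_simps flip: sum_divide_distrib)
qed

lemma mean_kemeny_cluster_root:
  assumes u: "u \<in> V1"
    and symm: "\<And>y. y \<in> V2 \<Longrightarrow> G2.mean_hitting_time y r = G2.mean_hitting_time r y"
  shows "GC.mean_kemeny (u, r) =
    real (card EC) / real (card E1) * G1.mean_kemeny u +
    real (card V1) * (2 * real (card EC) - real (card E2)) / real (card EC) * G2.mean_kemeny r"
proof -
  define \<alpha> where "\<alpha> = real (card EC) / real (card E1)"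
  define \<beta> where "\<beta> = (2 * real (card EC) - real (card E2)) / real (card E2)"
  let ?s = "stationary EC"
  have "GC.mean_kemeny (u, r) = (\<Sum>v\<in>V1. \<Sum>y\<in>V2. ?s (v, y) * GC.mean_hitting_time (u, r) (v, y))"
    by (simp only: GC.mean_kemeny_def sum_cluster_verts)
  also have "\<dots> = (\<Sum>v\<in>V1. \<Sum>y\<in>V2. ?s (v, y) *
      (\<alpha> * G1.mean_hitting_time u v + \<beta> * G2.mean_hitting_time r y))"
    unfolding \<alpha>_def \<beta>_def using u symm
    by (intro sum.cong refl arg_cong2[where f = "(*)"] mean_hitting_time_cluster_root)
  also have "\<dots> = \<alpha> * (\<Sum>v\<in>V1. (\<Sum>y\<in>V2. ?s (v, y)) * G1.mean_hitting_time u v) +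
      \<beta> * (\<Sum>v\<in>V1. \<Sum>y\<in>V2. ?s (v, y) * G2.mean_hitting_time r y)"
    by (simp add: algebra_simps sum.distrib sum_distrib_left sum_distrib_right)
  also have "(\<Sum>v\<in>V1. (\<Sum>y\<in>V2. ?s (v, y)) * G1.mean_hitting_time u v) = G1.mean_kemeny u"
    by (simp add: sum_stationary_cluster G1.mean_kemeny_def)
  \<comment> \<open>At \<open>y = r\<close> the degrees in the cluster and in the second graph differ, but the hitting time is \<open>0\<close>.\<close>
  also have "(\<Sum>v\<in>V1. \<Sum>y\<in>V2. ?s (v, y) * G2.mean_hitting_time r y) =
      (\<Sum>v\<in>V1. \<Sum>y\<in>V2. real (card E2) / real (card EC) * (stationary E2 y * G2.mean_hitting_time r y))"
    using G2.card_E_pos GC.card_E_pos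
    by (intro sum.cong refl) (auto simp: stationary_def degree_cluster)
  also have "\<dots> = real (card V1) * (real (card E2) / real (card EC)) * G2.mean_kemeny r"
    by (simp add: G2.mean_kemeny_def sum_distrib_left sum_divide_distrib mult_ac)
  finally show ?thesis
    using G2.card_E_pos by (simp add: \<alpha>_def \<beta>_def)
qed

end

section \<open>The Kemeny constant of a cluster of regular highly symmetric graphs\<close>

lemma walk_graph_regular:
  assumes "simple_graph V E" "connected_graph V E" "regular_graph V E d" "d \<ge> 1"
  shows "walk_graph V E"
proof
  show "neighbors E v \<noteq> {}" if "v \<in> V" for v
    using assms(3,4) that by (auto simp: regular_graph_def degree_def)
qed (use assms in auto)

theorem proposition1:
  fixes V1 :: "'a set" and E1 :: "'a set set" and V2 :: "'b set" and E2 :: "'b set set"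
    and V :: "('a \<times> 'b) set" and E :: "('a \<times> 'b) set set"
    and n1 n2 d1 d2 :: nat and r :: 'b and i :: "'a \<times> 'b" and i1 :: 'a and i2 :: 'b
  assumes "simple_graph V1 E1" and "connected_graph V1 E1"
    and "simple_graph V2 E2" and "connected_graph V2 E2"
    and "highly_symmetric V1 E1" and "highly_symmetric V2 E2"
    and "card V1 = n1" and "card V2 = n2"
    and "regular_graph V1 E1 d1" and "d1 \<ge> 1"
    and "regular_graph V2 E2 d2" and "d2 \<ge> 1"
    and "r \<in> V2"
    and "V = cluster_verts V1 V2" and "E = cluster_edges V1 E1 E2 r"
    and "i1 \<in> V1" and "i2 \<in> V2" and "i \<in> V"
  shows "card V = n1 * n2 \<and> card E = card E1 + n1 * card E2 \<and>
    kemeny V E i < \<infinity> \<and>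
    kemeny V E i =
      ennreal (real (card E) / real (card E1)) * kemeny V1 E1 i1 +
      ennreal (real n1 * (2 * real (card E) - real (card E2)) / real (card E)) * kemeny V2 E2 i2"
proof -
  interpret G1: walk_graph V1 E1
    by (rule walk_graph_regular) fact+
  interpret G2: walk_graph V2 E2
    by (rule walk_graph_regular) fact+
  interpret C: regular_cluster V1 E1 V2 E2 r d1
    by unfold_locales fact+
  have symm: "G2.mean_hitting_time y r = G2.mean_hitting_time r y" if "y \<in> V2" for y
    using \<open>highly_symmetric V2 E2\<close> that \<open>r \<in> V2\<close> unfolding highly_symmetric_def
    by (auto simp: G2.expected_hitting_time_eq G2.mean_hitting_time_nonneg dest!: bspec)
  have i: "i \<in> C.VC" "(i1, r) \<in> C.VC"
    using assms by (auto simp: cluster_verts_def)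
  have E: "E = C.EC" and V: "V = C.VC"
    by fact+
  have cardE: "card E = card E1 + n1 * card E2"
    using C.card_cluster_edges assms by simp
  have cardV: "card V = n1 * n2"
    using assms by (simp add: cluster_verts_def card_cartesian_product)
  \<comment> \<open>Addition and multiplication transfer to extended reals only for nonnegative factors.\<close>
  have coeff: "0 \<le> real n1 * (2 * real (card E) - real (card E2)) / real (card E)"
  proof (cases "n1 = 0")
    case False
    then have "card E2 \<le> card E"
      by (simp add: cardE trans_le_add2)
    then show ?thesis
      by (intro divide_nonneg_nonneg mult_nonneg_nonneg) auto
  qed simp
  have "kemeny V E i = ennreal (C.GC.mean_kemeny (i1, r))"
    unfolding E V using i C.GC.kemeny_eq C.GC.mean_kemeny_start_indep by metis
  also have "C.GC.mean_kemeny (i1, r) = real (card E) / real (card E1) * G1.mean_kemeny i1 +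
      real n1 * (2 * real (card E) - real (card E2)) / real (card E) * G2.mean_kemeny i2"
    using C.mean_kemeny_cluster_root[OF \<open>i1 \<in> V1\<close> symm] G2.mean_kemeny_start_indep[OF \<open>i2 \<in> V2\<close> \<open>r \<in> V2\<close>]
    by (simp add: E \<open>card V1 = n1\<close>)
  finally have K: "kemeny V E i = ennreal (real (card E) / real (card E1) * G1.mean_kemeny i1 +
      real n1 * (2 * real (card E) - real (card E2)) / real (card E) * G2.mean_kemeny i2)" .
  have "kemeny V E i = ennreal (real (card E) / real (card E1)) * kemeny V1 E1 i1 +
      ennreal (real n1 * (2 * real (card E) - real (card E2)) / real (card E)) * kemeny V2 E2 i2"
    unfolding K G1.kemeny_eq[OF \<open>i1 \<in> V1\<close>] G2.kemeny_eq[OF \<open>i2 \<in> V2\<close>]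
    using coeff G1.mean_kemeny_nonneg[OF \<open>i1 \<in> V1\<close>] G2.mean_kemeny_nonneg[OF \<open>i2 \<in> V2\<close>]
    by (simp add: ennreal_plus ennreal_mult del: times_divide_eq_left times_divide_eq_right)
  moreover have "kemeny V E i < \<infinity>"
    unfolding K by simp
  ultimately show ?thesis
    using cardV cardE by blast
qed

end
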